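(* Let $M_{\ell_1}$ be the countable metric graph defined in the context. Then: (i) $M_{\ell_1}$ does not Lipschitz embed with distortion $D<3$ into any stable metric space. (ii) The best constant $D$ such that $M_{\ell_1}$ Lipschitz embeds into $\ell_1$ with distortion $D$ is $D=3$; that is, $M_{\ell_1}$ Lipschitz embeds into $\ell_1$ with distortion $3$, and with no distortion $D<3$. (iii) $d_{BM}(\ell_1,\mathcal F(M_{\ell_1}))=3$, where $\mathcal F(M_{\ell_1})$ is the Lipschitz free space of $M_{\ell_1}$ and $d_{BM}$ is the Banach–Mazur distance.
   Context: Banach spaces are over the real scalars; $\mathbb N=\{1,2,\dots\}$. The metric space $M_{\ell_1}$: its vertex set is $\{\mathbf 0\}\cup\mathbb N\cup F$ (a disjoint union, where $\mathbf 0$ is an additional point) with $F=\{A\subset\mathbb N:1\le|A|<\infty\}$. In particular the integer $a$ and the singleton $\{a\}\in F$ are different vertices. A pair $\{a,b\}$ is an edge if and only if either $a=\mathbf 0$ and $b\in\mathbb N$, or $a\in\mathbb N$, $b\in F$ and $a\in b$. $M_{\ell_1}$ is equipped with the shortest path metric. Lipschitz embeddings: a map $f:(M,d)\to(N,\rho)$ between metric spaces is a Lipschitz embedding if there are constants $C_1,C_2>0$ with $C_1d(x,y)\le\rho(f(x),f(y))\le C_2d(x,y)$ for all $x,y\in M$. Its distortion is the infimum of $C_2/C_1$ over all such constants. $M$ Lipschitz embeds into $N$ with distortion $D$ if there is a Lipschitz embedding $f:M\to N$ whose distortion is at most $D$. A metric space $(M,d)$ is stable if for all bounded sequences $(x_n),(y_n)\subset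 M$ and all non-principal ultrafilters $\mathcal U,\mathcal V$ on $\mathbb N$ one has $\lim_{n,\mathcal U}\lim_{m,\mathcal V}d(x_n,y_m)=\lim_{m,\mathcal V}\lim_{n,\mathcal U}d(x_n,y_m)$. Lipschitz free space: for a metric space $M$ with base point $\mathbf 0$, $\mathrm{Lip}_0(M)$ is the Banach space of real Lipschitz functions on $M$ vanishing at $\mathbf 0$, normed by the best Lipschitz constant, and $\mathcal F(M)$ is the closed linear span in $\mathrm{Lip}_0(M)^*$ of the evaluation functionals $\delta_x:f\mapsto f(x)$, $x\in M$. The Banach–Mazur distance is $d_{BM}(X,Y)=\inf\{\|T\|\,\|T^{-1}\|: T:X\to Y \text{ a linear isomorphism onto}\}$. *)

theory Defs
  imports "HOL-Analysis.Analysis"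
begin

section \<open>Lipschitz embeddings and distortion\<close>

definition lipschitz_bounds :: "('a::metric_space \<Rightarrow> 'b::metric_space) \<Rightarrow> real \<Rightarrow> real \<Rightarrow> bool" where
  "lipschitz_bounds f C1 C2 \<longleftrightarrow> C1 > 0 \<and> C2 > 0 \<and>
     (\<forall>x y. C1 * dist x y \<le> dist (f x) (f y) \<and> dist (f x) (f y) \<le> C2 * dist x y)"

definition lipschitz_embedding :: "('a::metric_space \<Rightarrow> 'b::metric_space) \<Rightarrow> bool" where
  "lipschitz_embedding f \<longleftrightarrow> (\<exists>C1 C2. lipschitz_bounds f C1 C2)"

definition distortion :: "('a::metric_space \<Rightarrow> 'b::metric_space) \<Rightarrow> real" where
  "distortion f = Inf {C2 / C1 | C1 C2. lipschitz_bounds f C1 C2}"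

definition lipschitz_embeds ::
    "'a::metric_space itself \<Rightarrow> 'b::metric_space itself \<Rightarrow> real \<Rightarrow> bool" where
  "lipschitz_embeds _ _ D \<longleftrightarrow> (\<exists>f :: 'a \<Rightarrow> 'b. lipschitz_embedding f \<and> distortion f \<le> D)"


section \<open>Stable metric spaces\<close>

definition ultrafilter :: "'a filter \<Rightarrow> bool" where
  "ultrafilter U \<longleftrightarrow> U \<noteq> bot \<and> (\<forall>P. eventually P U \<or> eventually (\<lambda>x. \<not> P x) U)"

definition nonprincipal_ultrafilter :: "'a filter \<Rightarrow> bool" where
  "nonprincipal_ultrafilter U \<longleftrightarrow> ultrafilter U \<and> (\<forall>a. U \<noteq> principal {a})"

text \<open>The limits below always exist: along an ultrafilter every bounded real sequence converges.\<close>

definition stable_metric_space :: "'a::metric_space itself \<Rightarrow> bool" where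
  "stable_metric_space _ \<longleftrightarrow>
     (\<forall>(x :: nat \<Rightarrow> 'a) (y :: nat \<Rightarrow> 'a) U V.
        bounded (range x) \<longrightarrow> bounded (range y) \<longrightarrow>
        nonprincipal_ultrafilter U \<longrightarrow> nonprincipal_ultrafilter V \<longrightarrow>
        Lim U (\<lambda>n. Lim V (\<lambda>m. dist (x n) (y m))) =
        Lim V (\<lambda>m. Lim U (\<lambda>n. dist (x n) (y m))))"


section \<open>The Banach-Mazur distance\<close>

text \<open>The value is \<open>\<infinity>\<close> (the infimum of the empty set) for non-isomorphic spaces.\<close>

definition banach_mazur_distance :: "'a::banach itself \<Rightarrow> 'b::banach itself \<Rightarrow> ereal" where
  "banach_mazur_distance _ _ =
     Inf {ereal (onorm T * onorm (inv T)) | T :: 'a \<Rightarrow> 'b.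
            bounded_linear T \<and> bij T \<and> bounded_linear (inv T)}"


section \<open>The sequence space \<open>\<ell>\<^sub>1\<close>\<close>

typedef ell1 = "{x :: nat \<Rightarrow> real. summable (\<lambda>n. \<bar>x n\<bar>)}"
  morphisms ell1_nth Abs_ell1
  by (rule exI[of _ "\<lambda>_. 0"]) simp

setup_lifting type_definition_ell1

lemma ell1_summable: "summable (\<lambda>n. \<bar>ell1_nth x n\<bar>)"
  using ell1_nth[of x] by simp

instantiation ell1 :: real_vector
begin

lift_definition zero_ell1 :: ell1 is "\<lambda>_. 0"
  by simp

lift_definition plus_ell1 :: "ell1 \<Rightarrow> ell1 \<Rightarrow> ell1" is "\<lambda>x y n. x n + y n"
proof -
  fix x y :: "nat \<Rightarrow> real"
  assume "summable (\<lambda>n. \<bar>x n\<bar>)" "summable (\<lambda>n. \<bar>y n\<bar>)"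
  from summable_add[OF this] show "summable (\<lambda>n. \<bar>x n + y n\<bar>)"
    by (rule summable_comparison_test'[where N = 0]) auto
qed

lift_definition uminus_ell1 :: "ell1 \<Rightarrow> ell1" is "\<lambda>x n. - x n"
  by simp

lift_definition minus_ell1 :: "ell1 \<Rightarrow> ell1 \<Rightarrow> ell1" is "\<lambda>x y n. x n - y n"
proof -
  fix x y :: "nat \<Rightarrow> real"
  assume "summable (\<lambda>n. \<bar>x n\<bar>)" "summable (\<lambda>n. \<bar>y n\<bar>)"
  from summable_add[OF this] show "summable (\<lambda>n. \<bar>x n - y n\<bar>)"
    by (rule summable_comparison_test'[where N = 0]) auto
qed

lift_definition scaleR_ell1 :: "real \<Rightarrow> ell1 \<Rightarrow> ell1" is "\<lambda>r x n. r * x n"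
  by (simp add: abs_mult summable_mult)

instance
  by standard (transfer; simp add: algebra_simps fun_eq_iff)+

end

instantiation ell1 :: real_normed_vector
begin

lift_definition norm_ell1 :: "ell1 \<Rightarrow> real" is "\<lambda>x. \<Sum>n. \<bar>x n\<bar>" .

definition dist_ell1 :: "ell1 \<Rightarrow> ell1 \<Rightarrow> real" where
  "dist_ell1 x y = norm (x - y)"

definition sgn_ell1 :: "ell1 \<Rightarrow> ell1" where
  "sgn_ell1 x = x /\<^sub>R norm x"

definition uniformity_ell1 :: "(ell1 \<times> ell1) filter" where
  "uniformity_ell1 = (INF e\<in>{0 <..}. principal {(x, y). dist x y < e})"

definition open_ell1 :: "ell1 set \<Rightarrow> bool" where
  "open_ell1 S = (\<forall>x\<in>S. \<forall>\<^sub>F (x', y) in uniformity. x' = x \<longrightarrow> y \<in> S)"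

instance
proof
  fix x y :: ell1 and r :: real
  show "norm x = 0 \<longleftrightarrow> x = 0"
    by transfer (auto simp: suminf_eq_zero_iff fun_eq_iff)
  show "norm (x + y) \<le> norm x + norm y"
  proof transfer
    fix x y :: "nat \<Rightarrow> real"
    assume "summable (\<lambda>n. \<bar>x n\<bar>)" "summable (\<lambda>n. \<bar>y n\<bar>)"
    note s = summable_add[OF this] and xy = this
    have "summable (\<lambda>n. \<bar>x n + y n\<bar>)"
      by (rule summable_comparison_test'[OF s, where N = 0]) auto
    then have "(\<Sum>n. \<bar>x n + y n\<bar>) \<le> (\<Sum>n. \<bar>x n\<bar> + \<bar>y n\<bar>)"
      by (intro suminf_le s) auto
    also have "\<dots> = (\<Sum>n. \<bar>x n\<bar>) + (\<Sum>n. \<bar>y n\<bar>)"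
      by (rule suminf_add[OF xy, symmetric])
    finally show "(\<Sum>n. \<bar>x n + y n\<bar>) \<le> (\<Sum>n. \<bar>x n\<bar>) + (\<Sum>n. \<bar>y n\<bar>)" .
  qed
  show "norm (r *\<^sub>R x) = \<bar>r\<bar> * norm x"
    by transfer (simp add: abs_mult suminf_mult)
qed (simp_all add: dist_ell1_def sgn_ell1_def uniformity_ell1_def open_ell1_def)

end

lemma ell1_sum_le_norm: "finite A \<Longrightarrow> (\<Sum>n\<in>A. \<bar>ell1_nth x n\<bar>) \<le> norm x"
  unfolding norm_ell1.rep_eq by (rule sum_le_suminf) (auto simp: ell1_summable)

instance ell1 :: banach
proof
  fix X :: "nat \<Rightarrow> ell1"
  assume X: "Cauchy X"
  have diff: "\<bar>ell1_nth u n - ell1_nth v n\<bar> \<le> norm (u - v)" for u v n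
    using ell1_sum_le_norm[of "{n}" "u - v"] by (simp add: minus_ell1.rep_eq)
  have "Cauchy (\<lambda>k. ell1_nth (X k) n)" for n
    unfolding Cauchy_def
  proof (intro allI impI)
    fix e :: real
    assume "e > 0"
    then obtain N where "\<forall>j\<ge>N. \<forall>k\<ge>N. norm (X j - X k) < e"
      using X by (auto simp: Cauchy_iff)
    then show "\<exists>N. \<forall>j\<ge>N. \<forall>k\<ge>N. dist (ell1_nth (X j) n) (ell1_nth (X k) n) < e"
      unfolding dist_real_def using diff le_less_trans by blast
  qed
  then obtain l where l: "\<And>n. (\<lambda>k. ell1_nth (X k) n) \<longlonglongrightarrow> l n"
    unfolding Cauchy_convergent_iff convergent_def by metis
  have tail: "\<exists>N. \<forall>k\<ge>N. \<forall>m. (\<Sum>n<m. \<bar>ell1_nth (X k) n - l n\<bar>) \<le> e" if "e > 0" for e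
  proof -
    obtain N where N: "\<And>j k. j \<ge> N \<Longrightarrow> k \<ge> N \<Longrightarrow> norm (X j - X k) < e"
      using X \<open>e > 0\<close> unfolding Cauchy_iff by blast
    have "(\<Sum>n<m. \<bar>ell1_nth (X k) n - l n\<bar>) \<le> e" if "k \<ge> N" for k m
    proof (rule LIMSEQ_le_const2)
      show "(\<lambda>j. \<Sum>n<m. \<bar>ell1_nth (X k) n - ell1_nth (X j) n\<bar>)
              \<longlonglongrightarrow> (\<Sum>n<m. \<bar>ell1_nth (X k) n - l n\<bar>)"
        by (intro tendsto_intros l)
      have "(\<Sum>n<m. \<bar>ell1_nth (X k) n - ell1_nth (X j) n\<bar>) \<le> e" if "j \<ge> N" for j
        using ell1_sum_le_norm[of "{..<m}" "X k - X j"] N[OF \<open>k \<ge> N\<close> that]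
        by (simp add: minus_ell1.rep_eq)
      then show "\<exists>N. \<forall>j\<ge>N. (\<Sum>n<m. \<bar>ell1_nth (X k) n - ell1_nth (X j) n\<bar>) \<le> e"
        by blast
    qed
    then show ?thesis by blast
  qed
  have summ: "summable (\<lambda>n. \<bar>ell1_nth (X k) n - l n\<bar>) \<and> (\<Sum>n. \<bar>ell1_nth (X k) n - l n\<bar>) \<le> e"
    if "\<forall>m. (\<Sum>n<m. \<bar>ell1_nth (X k) n - l n\<bar>) \<le> e" for k e
  proof (rule conjI)
    show *: "summable (\<lambda>n. \<bar>ell1_nth (X k) n - l n\<bar>)"
      by (rule summableI_nonneg_bounded[of _ e]) (simp_all add: that)
    show "(\<Sum>n. \<bar>ell1_nth (X k) n - l n\<bar>) \<le> e"
      using * that by (intro suminf_le_const) simp_all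
  qed
  obtain k0 where "summable (\<lambda>n. \<bar>ell1_nth (X k0) n - l n\<bar>)"
    using tail[OF zero_less_one] summ by blast
  then have "summable (\<lambda>n. \<bar>ell1_nth (X k0) n\<bar> + \<bar>ell1_nth (X k0) n - l n\<bar>)"
    by (intro summable_add ell1_summable)
  then have "summable (\<lambda>n. \<bar>l n\<bar>)"
    by (rule summable_comparison_test'[where N = 0]) auto
  then have nth: "ell1_nth (Abs_ell1 l) = l"
    by (simp add: Abs_ell1_inverse)
  have "X \<longlonglongrightarrow> Abs_ell1 l"
  proof (rule LIMSEQ_I)
    fix e :: real
    assume "e > 0"
    then obtain N where "\<And>k m. k \<ge> N \<Longrightarrow> (\<Sum>n<m. \<bar>ell1_nth (X k) n - l n\<bar>) \<le> e / 2"
      using tail[of "e / 2"] by auto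
    then have "norm (X k - Abs_ell1 l) \<le> e / 2" if "k \<ge> N" for k
      using summ[of k "e / 2"] that by (simp add: norm_ell1.rep_eq minus_ell1.rep_eq nth)
    then show "\<exists>N. \<forall>k\<ge>N. norm (X k - Abs_ell1 l) < e"
      using \<open>e > 0\<close> by (intro exI[of _ N]) force
  qed
  then show "convergent X"
    by (auto simp: convergent_def)
qed


section \<open>Lipschitz free spaces\<close>

class pointed_metric_space = metric_space +
  fixes base_point :: 'a

typedef (overloaded) 'a lip0 =
    "{f :: 'a::pointed_metric_space \<Rightarrow> real. (\<exists>C. C-lipschitz_on UNIV f) \<and> f base_point = 0}"
  morphisms lip0_apply Abs_lip0
  by (rule exI[of _ "\<lambda>_. 0"]) (auto intro!: exI[of _ 0] lipschitz_onI)

setup_lifting type_definition_lip0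

instantiation lip0 :: (pointed_metric_space) real_vector
begin

lift_definition zero_lip0 :: "'a lip0" is "\<lambda>_. 0"
  by (auto intro!: exI[of _ 0] lipschitz_onI)

lift_definition plus_lip0 :: "'a lip0 \<Rightarrow> 'a lip0 \<Rightarrow> 'a lip0" is "\<lambda>f g x. f x + g x"
  by (auto intro: lipschitz_on_add)

lift_definition uminus_lip0 :: "'a lip0 \<Rightarrow> 'a lip0" is "\<lambda>f x. - f x"
  by (auto simp: lipschitz_on_minus)

lift_definition minus_lip0 :: "'a lip0 \<Rightarrow> 'a lip0 \<Rightarrow> 'a lip0" is "\<lambda>f g x. f x - g x"
  by (auto intro: lipschitz_on_diff)

lift_definition scaleR_lip0 :: "real \<Rightarrow> 'a lip0 \<Rightarrow> 'a lip0" is "\<lambda>r f x. r * f x"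
  by (auto intro: lipschitz_on_cmult_real)

instance
  by standard (transfer; simp add: algebra_simps fun_eq_iff)+

end

instantiation lip0 :: (pointed_metric_space) real_normed_vector
begin

lift_definition norm_lip0 :: "'a lip0 \<Rightarrow> real" is "\<lambda>f. Inf {C. C-lipschitz_on UNIV f}" .

definition dist_lip0 :: "'a lip0 \<Rightarrow> 'a lip0 \<Rightarrow> real" where
  "dist_lip0 f g = norm (f - g)"

definition sgn_lip0 :: "'a lip0 \<Rightarrow> 'a lip0" where
  "sgn_lip0 f = f /\<^sub>R norm f"

definition uniformity_lip0 :: "('a lip0 \<times> 'a lip0) filter" where
  "uniformity_lip0 = (INF e\<in>{0 <..}. principal {(f, g). dist f g < e})"

definition open_lip0 :: "'a lip0 set \<Rightarrow> bool" where
  "open_lip0 S = (\<forall>f\<in>S. \<forall>\<^sub>F (f', g) in uniformity. f' = f \<longrightarrow> g \<in> S)"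

lemma lip0_norm_le: "C-lipschitz_on UNIV (lip0_apply f) \<Longrightarrow> norm f \<le> C"
  unfolding norm_lip0.rep_eq
  by (rule cInf_lower) (auto intro!: bdd_belowI[of _ 0] lipschitz_on_nonneg)

lemma lip0_norm_nonneg: "0 \<le> norm f" for f :: "'a lip0"
  unfolding norm_lip0.rep_eq using lip0_apply[of f]
  by (intro cInf_greatest) (auto intro: lipschitz_on_nonneg)

lemma lip0_lipschitz: "(norm f)-lipschitz_on UNIV (lip0_apply f)" for f :: "'a lip0"
proof (rule lipschitz_onI)
  fix x y :: 'a
  obtain C0 where C0: "C0-lipschitz_on UNIV (lip0_apply f)"
    using lip0_apply[of f] by auto
  show "dist (lip0_apply f x) (lip0_apply f y) \<le> norm f * dist x y"
  proof (cases "x = y")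
    case False
    have "dist (lip0_apply f x) (lip0_apply f y) / dist x y \<le> norm f"
      unfolding norm_lip0.rep_eq
      using C0 False by (intro cInf_greatest) (auto simp: divide_simps dest: lipschitz_onD)
    with False show ?thesis by (simp add: divide_simps)
  qed simp
qed (rule lip0_norm_nonneg)

instance
proof
  fix f g :: "'a lip0" and r :: real
  show "norm f = 0 \<longleftrightarrow> f = 0"
  proof
    assume "norm f = 0"
    then have "lip0_apply f x = lip0_apply f base_point" for x
      using lipschitz_onD[OF lip0_lipschitz[of f], of x base_point] by simp
    then show "f = 0"
      using lip0_apply[of f] by (simp add: lip0_apply_inject[symmetric] zero_lip0.rep_eq fun_eq_iff)
  next
    assume "f = 0"
    then have "norm f \<le> 0"
      by (intro lip0_norm_le lipschitz_onI) (auto simp: zero_lip0.rep_eq)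
    then show "norm f = 0"
      using lip0_norm_nonneg[of f] by simp
  qed
  show "norm (f + g) \<le> norm f + norm g"
    by (rule lip0_norm_le) (simp add: plus_lip0.rep_eq lipschitz_on_add lip0_lipschitz)
  have le: "norm (r *\<^sub>R f) \<le> \<bar>r\<bar> * norm f" for r and f :: "'a lip0"
    by (rule lip0_norm_le) (simp add: scaleR_lip0.rep_eq lipschitz_on_cmult_real lip0_lipschitz)
  show "norm (r *\<^sub>R f) = \<bar>r\<bar> * norm f"
  proof (cases "r = 0")
    case True
    then show ?thesis
      using le[of 0 f] lip0_norm_nonneg[of "0 *\<^sub>R f"] by simp
  next
    case False
    then have "norm f \<le> norm (r *\<^sub>R f) / \<bar>r\<bar>"
      using le[of "inverse r" "r *\<^sub>R f"] by (simp add: divide_inverse mult.commute)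
    then have "\<bar>r\<bar> * norm f \<le> norm (r *\<^sub>R f)"
      using False by (simp add: pos_le_divide_eq mult.commute)
    with le[of r f] show ?thesis by (rule antisym)
  qed
qed (simp_all add: dist_lip0_def sgn_lip0_def uniformity_lip0_def open_lip0_def)

end

lift_definition lip0_eval :: "'a::pointed_metric_space \<Rightarrow> ('a lip0 \<Rightarrow>\<^sub>L real)"
  is "\<lambda>x f. lip0_apply f x"
proof (rule bounded_linear_intro)
  fix x :: 'a and f :: "'a lip0"
  show "norm (lip0_apply f x) \<le> norm f * dist x base_point"
    using lipschitz_onD[OF lip0_lipschitz[of f], of x base_point] lip0_apply[of f]
    by (simp add: dist_real_def)
qed (simp_all add: plus_lip0.rep_eq scaleR_lip0.rep_eq)

typedef (overloaded) 'a free_space =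
    "closure (span (range lip0_eval)) :: ('a::pointed_metric_space lip0 \<Rightarrow>\<^sub>L real) set"
  morphisms free_space_functional Abs_free_space
  by (rule exI[of _ 0]) (rule subsetD[OF closure_subset span_zero])

setup_lifting type_definition_free_space

lemma subspace_free_space:
  "subspace (closure (span (range lip0_eval)) :: ('a::pointed_metric_space lip0 \<Rightarrow>\<^sub>L real) set)"
  unfolding subspace_def
proof (intro conjI ballI allI)
  let ?S = "span (range lip0_eval) :: ('a lip0 \<Rightarrow>\<^sub>L real) set"
  show "0 \<in> closure ?S"
    by (rule subsetD[OF closure_subset span_zero])
  fix u assume u: "u \<in> closure ?S"
  then obtain a where a: "\<And>n. a n \<in> ?S" "a \<longlonglongrightarrow> u"
    unfolding closure_sequential by blast
  show "c *\<^sub>R u \<in> closure ?S" for c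
    unfolding closure_sequential
    by (rule exI[of _ "\<lambda>n. c *\<^sub>R a n"]) (simp add: a span_scale tendsto_scaleR)
  fix v assume "v \<in> closure ?S"
  then obtain b where b: "\<And>n. b n \<in> ?S" "b \<longlonglongrightarrow> v"
    unfolding closure_sequential by blast
  show "u + v \<in> closure ?S"
    unfolding closure_sequential
    by (rule exI[of _ "\<lambda>n. a n + b n"]) (simp add: a b span_add tendsto_add)
qed

instantiation free_space :: (pointed_metric_space) real_vector
begin

lift_definition zero_free_space :: "'a free_space" is 0
  by (rule subspace_0[OF subspace_free_space])

lift_definition plus_free_space :: "'a free_space \<Rightarrow> 'a free_space \<Rightarrow> 'a free_space" is "(+)"
  by (rule subspace_add[OF subspace_free_space])

lift_definition uminus_free_space :: "'a free_space \<Rightarrow> 'a free_space" is uminus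
  by (rule subspace_neg[OF subspace_free_space])

lift_definition minus_free_space :: "'a free_space \<Rightarrow> 'a free_space \<Rightarrow> 'a free_space" is "(-)"
  by (rule subspace_diff[OF subspace_free_space])

lift_definition scaleR_free_space :: "real \<Rightarrow> 'a free_space \<Rightarrow> 'a free_space" is "(*\<^sub>R)"
  by (rule subspace_scale[OF subspace_free_space])

instance
  by standard (transfer; simp add: algebra_simps)+

end

instantiation free_space :: (pointed_metric_space) real_normed_vector
begin

lift_definition norm_free_space :: "'a free_space \<Rightarrow> real" is norm .

definition dist_free_space :: "'a free_space \<Rightarrow> 'a free_space \<Rightarrow> real" where
  "dist_free_space u v = norm (u - v)"

definition sgn_free_space :: "'a free_space \<Rightarrow> 'a free_space" where
  "sgn_free_space u = u /\<^sub>R norm u"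

definition uniformity_free_space :: "('a free_space \<times> 'a free_space) filter" where
  "uniformity_free_space = (INF e\<in>{0 <..}. principal {(u, v). dist u v < e})"

definition open_free_space :: "'a free_space set \<Rightarrow> bool" where
  "open_free_space S = (\<forall>u\<in>S. \<forall>\<^sub>F (u', v) in uniformity. u' = u \<longrightarrow> v \<in> S)"

instance
proof
  fix u v :: "'a free_space" and r :: real
  show "norm u = 0 \<longleftrightarrow> u = 0" by transfer simp
  show "norm (u + v) \<le> norm u + norm v" by transfer (rule norm_triangle_ineq)
  show "norm (r *\<^sub>R u) = \<bar>r\<bar> * norm u" by transfer simp
qed (simp_all add: dist_free_space_def sgn_free_space_def uniformity_free_space_def
      open_free_space_def)

end

instance free_space :: (pointed_metric_space) banach
proof
  fix X :: "nat \<Rightarrow> 'a free_space"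
  assume "Cauchy X"
  have dist: "dist u v = dist (free_space_functional u) (free_space_functional v)"
    for u v :: "'a free_space"
    by (simp add: dist_free_space_def dist_norm norm_free_space.rep_eq minus_free_space.rep_eq)
  have "Cauchy (\<lambda>n. free_space_functional (X n))"
    using \<open>Cauchy X\<close> unfolding Cauchy_def dist .
  then obtain l where l: "(\<lambda>n. free_space_functional (X n)) \<longlonglongrightarrow> l"
    unfolding Cauchy_convergent_iff convergent_def by blast
  then have "l \<in> closure (span (range lip0_eval))"
    by (rule closed_sequentially[OF closed_closure free_space_functional])
  then have "free_space_functional (Abs_free_space l) = l"
    by (rule Abs_free_space_inverse)
  with l have "X \<longlonglongrightarrow> Abs_free_space l"
    by (simp add: lim_sequentially dist)
  then show "convergent X"
    by (auto simp: convergent_def)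
qed


section \<open>The metric graph \<open>M\<close> associated with \<open>\<ell>\<^sub>1\<close>\<close>

text \<open>A walk of length \<open>n\<close> is an element of the \<open>n\<close>-th relational power of the adjacency relation.\<close>

definition graph_dist :: "'a set set \<Rightarrow> 'a \<Rightarrow> 'a \<Rightarrow> nat" where
  "graph_dist E u v = (LEAST n. (u, v) \<in> {(a, b). {a, b} \<in> E} ^^ n)"

datatype ml1_label = Origin | Number nat | Subset "nat set"

definition ml1_vertices :: "ml1_label set" where
  "ml1_vertices =
     {Origin} \<union> {Number n | n. n \<ge> 1} \<union> {Subset A | A. A \<subseteq> {1..} \<and> finite A \<and> A \<noteq> {}}"

definition ml1_edges :: "ml1_label set set" where
  "ml1_edges =
     {{Origin, Number n} | n. Number n \<in> ml1_vertices} \<union>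
     {{Number n, Subset A} | n A. Number n \<in> ml1_vertices \<and> Subset A \<in> ml1_vertices \<and> n \<in> A}"

typedef ml1 = ml1_vertices
  morphisms ml1_label Abs_ml1
  by (rule exI[of _ Origin]) (simp add: ml1_vertices_def)

lemma ml1_walk_from_Origin:
  assumes "v \<in> ml1_vertices"
  shows "\<exists>n. (Origin, v) \<in> {(a, b). {a, b} \<in> ml1_edges} ^^ n"
proof (cases v)
  case Origin
  then show ?thesis by (intro exI[of _ 0]) simp
next
  case (Number k)
  with assms show ?thesis
    by (intro exI[of _ "Suc 0"]) (auto simp: ml1_edges_def)
next
  case (Subset A)
  with assms obtain k where "k \<in> A" "k \<ge> 1"
    by (auto simp: ml1_vertices_def)
  then have "Number k \<in> ml1_vertices" by (simp add: ml1_vertices_def)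
  with assms Subset \<open>k \<in> A\<close> show ?thesis
    by (intro exI[of _ "Suc (Suc 0)"]) (auto simp: ml1_edges_def intro!: relcompI[of _ "Number k"])
qed

lemma graph_walk_sym:
  "(u, v) \<in> {(a, b). {a, b} \<in> E} ^^ n \<Longrightarrow> (v, u) \<in> {(a, b). {a, b} \<in> E} ^^ n"
proof (induction n arbitrary: v)
  case (Suc n)
  then obtain w where "(w, u) \<in> {(a, b). {a, b} \<in> E} ^^ n" "{w, v} \<in> E"
    by auto
  then show ?case
    by (intro relpow_Suc_I2[of v w]) (auto simp: insert_commute)
qed simp

lemma ml1_connected:
  assumes "u \<in> ml1_vertices" "v \<in> ml1_vertices"
  shows "\<exists>n. (u, v) \<in> {(a, b). {a, b} \<in> ml1_edges} ^^ n"
proof -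
  let ?R = "{(a, b). {a, b} \<in> ml1_edges}"
  obtain m n where "(Origin, u) \<in> ?R ^^ m" "(Origin, v) \<in> ?R ^^ n"
    using ml1_walk_from_Origin assms by blast
  then have "(u, v) \<in> ?R ^^ (m + n)"
    unfolding relpow_add by (blast intro: graph_walk_sym)
  then show ?thesis ..
qed

instantiation ml1 :: pointed_metric_space
begin

definition dist_ml1 :: "ml1 \<Rightarrow> ml1 \<Rightarrow> real" where
  "dist_ml1 x y = real (graph_dist ml1_edges (ml1_label x) (ml1_label y))"

definition uniformity_ml1 :: "(ml1 \<times> ml1) filter" where
  "uniformity_ml1 = (INF e\<in>{0 <..}. principal {(x, y). dist x y < e})"

definition open_ml1 :: "ml1 set \<Rightarrow> bool" where
  "open_ml1 S = (\<forall>x\<in>S. \<forall>\<^sub>F (x', y) in uniformity. x' = x \<longrightarrow> y \<in> S)"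

definition base_point_ml1 :: ml1 where
  "base_point_ml1 = Abs_ml1 Origin"

instance
proof
  fix x y z :: ml1
  let ?R = "{(a, b). {a, b} \<in> ml1_edges}"
  have walk: "(ml1_label u, ml1_label v) \<in> ?R ^^ graph_dist ml1_edges (ml1_label u) (ml1_label v)"
    for u v
    unfolding graph_dist_def by (rule LeastI_ex) (rule ml1_connected[OF ml1_label ml1_label])
  have le: "graph_dist ml1_edges a b \<le> n" if "(a, b) \<in> ?R ^^ n" for a b n
    unfolding graph_dist_def using that by (rule Least_le)
  show "dist x y = 0 \<longleftrightarrow> x = y"
  proof
    assume "dist x y = 0"
    with walk[of x y] show "x = y"
      by (simp add: dist_ml1_def ml1_label_inject)
  next
    assume "x = y"
    then show "dist x y = 0"
      using le[of "ml1_label x" "ml1_label x" 0] by (simp add: dist_ml1_def)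
  qed
  have sym: "graph_dist ml1_edges (ml1_label u) (ml1_label v)
      \<le> graph_dist ml1_edges (ml1_label v) (ml1_label u)" for u v
    by (rule le[OF graph_walk_sym[OF walk]])
  have "(ml1_label x, ml1_label y) \<in> ?R ^^ (graph_dist ml1_edges (ml1_label x) (ml1_label z) +
      graph_dist ml1_edges (ml1_label z) (ml1_label y))"
    unfolding relpow_add by (rule relcompI[OF walk walk])
  from le[OF this] sym[of z y] show "dist x y \<le> dist x z + dist y z"
    unfolding dist_ml1_def by linarith
qed (simp_all add: uniformity_ml1_def open_ml1_def)

end

end

theory Submission
  imports Defs
begin

text \<open>
  Write \<open>M\<close> for the graph. Both bounds of the theorem meet at the ratio between the two distances
  that occur between a number \<open>n\<close> and a finite set \<open>A\<close>: the distance is \<open>1\<close> if \<open>n \<in> A\<close> and \<open>3\<close>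
  otherwise, because the shortest way from \<open>n\<close> to \<open>A\<close> then passes through the origin.

  Lower bound. For the vertices \<open>x\<^sub>n = n\<close> and \<open>y\<^sub>m = {1,\<dots>,m}\<close> the iterated limits of the distances
  in the two orders are \<open>1\<close> and \<open>3\<close>. In a stable space the iterated limits of the distances between
  the images agree, one of them being at most \<open>C\<^sub>2\<close> and the other at least \<open>3 C\<^sub>1\<close>; so
  \<open>C\<^sub>2 \<ge> 3 C\<^sub>1\<close> (\<open>stable_lipschitz_bounds\<close>). The space \<open>\<ell>\<^sub>1\<close> is stable, since along an ultrafilter a
  bounded sequence converges coordinatewise to some \<open>p\<close>, and its distance to any point \<open>z\<close> tends to
  \<open>\<parallel>p - z\<parallel> + a\<close> with \<open>a\<close> independent of \<open>z\<close> (\<open>ell1_ultralimit_dist\<close>); both iterated limits are then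
  \<open>\<parallel>p - q\<parallel> + a + b\<close>. As \<open>M\<close> sits isometrically in its free space (\<open>dist_free_delta\<close>), an isomorphism
  \<open>T\<close> of \<open>\<ell>\<^sub>1\<close> onto the free space yields a Lipschitz embedding of \<open>M\<close> into \<open>\<ell>\<^sub>1\<close> with constants
  \<open>1 / \<parallel>T\<parallel>\<close> and \<open>\<parallel>T\<^sup>-\<^sup>1\<parallel>\<close>, so that \<open>\<parallel>T\<parallel> \<parallel>T\<^sup>-\<^sup>1\<parallel> \<ge> 3\<close>.

  Upper bound. Join every set \<open>A\<close> only to its least element, and every number to the origin. The
  result is a spanning tree; an edge of \<open>M\<close> outside it is bridged by three tree edges
  \<open>n\<close> -- \<open>0\<close> -- \<open>Min A\<close> -- \<open>A\<close>, so the tree metric \<open>d\<^sub>t\<close> satisfies \<open>d \<le> d\<^sub>t \<le> 3 d\<close>. The free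
  space of a tree is \<open>\<ell>\<^sub>1\<close> over its edges, an edge from \<open>x\<close> to its parent \<open>x'\<close> corresponding to
  \<open>\<delta>\<^sub>x - \<delta>\<^sub>x\<^sub>'\<close>. Hence the operator \<open>T\<close> that maps unit vectors to these differences is an isomorphism
  of \<open>\<ell>\<^sub>1\<close> onto the free space of \<open>M\<close> with \<open>\<parallel>T\<parallel> \<le> 1\<close> and \<open>\<parallel>T\<^sup>-\<^sup>1\<parallel> \<le> 3\<close>
  (\<open>ell1_free_ml1_isomorphism\<close>), and \<open>x \<mapsto> T\<^sup>-\<^sup>1 \<delta>\<^sub>x\<close> embeds \<open>M\<close> into \<open>\<ell>\<^sub>1\<close> with distortion \<open>3\<close>.
\<close>

section \<open>Ultrafilters and stable metric spaces\<close>

text \<open>Zorn's lemma gives a minimal proper filter below \<open>F\<close>: the infimum of a chain of proper filters is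
  proper. Minimality decides every predicate \<open>P\<close>, since intersecting with \<open>P\<close> either gives nothing
  new or destroys the filter.\<close>

lemma ultrafilter_below:
  assumes "F \<noteq> bot"
  shows "\<exists>U\<le>F. ultrafilter U"
proof -
  let ?A = "{G. G \<noteq> bot \<and> G \<le> F}"
  have "\<exists>U\<in>?A. \<forall>G\<in>?A. G \<le> U \<longrightarrow> G = U"
  proof (rule predicate_Zorn)
    show "partial_order_on ?A (relation_of (\<lambda>G H. H \<le> G) ?A)"
      by (rule partial_order_on_relation_ofI) auto
    fix C assume C: "C \<in> Chains (relation_of (\<lambda>G H. H \<le> G) ?A)"
    show "\<exists>U\<in>?A. \<forall>G\<in>C. U \<le> G"
    proof (cases "C = {}")
      case True
      then show ?thesis using assms by auto
    next
      case False
      have CA: "C \<subseteq> ?A" by (rule Chains_relation_of[OF C])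
      have "\<exists>K\<in>C. K \<le> inf G H" if "G \<in> C" "H \<in> C" for G H
        using C that unfolding Chains_def relation_of_def by fastforce
      then have "eventually (\<lambda>_. False) (Inf C) \<longleftrightarrow> (\<exists>G\<in>C. eventually (\<lambda>_. False) G)"
        by (rule eventually_Inf_base[OF False])
      then have "Inf C \<noteq> bot"
        using CA by (auto simp: trivial_limit_def)
      moreover have "Inf C \<le> F"
        using False CA by (auto intro: Inf_lower2)
      ultimately show ?thesis
        by (auto intro: Inf_lower)
    qed
  qed
  then obtain U where U: "U \<noteq> bot" "U \<le> F"
    and min: "\<And>G. G \<noteq> bot \<Longrightarrow> G \<le> F \<Longrightarrow> G \<le> U \<Longrightarrow> G = U"
    by blast
  have "eventually P U \<or> eventually (\<lambda>x. \<not> P x) U" for P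
  proof (cases "inf U (principal {x. P x}) = bot")
    case True
    then have "eventually (\<lambda>x. \<not> P x) U"
      by (simp add: trivial_limit_def eventually_inf_principal)
    then show ?thesis ..
  next
    case False
    then have "inf U (principal {x. P x}) = U"
      using U(2) by (intro min) (auto intro: le_infI1)
    then have "U \<le> principal {x. P x}"
      by (metis inf_le2)
    then show ?thesis
      by (simp add: le_principal)
  qed
  with U show ?thesis
    by (auto simp: ultrafilter_def)
qed

text \<open>In this form the two uses are immediate: an ultrafilter below \<open>sequentially\<close> is nonprincipal, and
  along a nonprincipal ultrafilter a property may be checked for all large \<open>n\<close> only.\<close>

lemma nonprincipal_ultrafilter_iff:
  fixes U :: "'a filter"
  shows "nonprincipal_ultrafilter U \<longleftrightarrow> ultrafilter U \<and> U \<le> cofinite"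
proof (intro iffI conjI)
  assume U: "nonprincipal_ultrafilter U"
  then show u: "ultrafilter U"
    by (simp add: nonprincipal_ultrafilter_def)
  have ne: "eventually (\<lambda>x. x \<noteq> a) U" for a
  proof (rule ccontr)
    assume "\<not> eventually (\<lambda>x. x \<noteq> a) U"
    then have a: "eventually (\<lambda>x. x = a) U"
      using u by (auto simp: ultrafilter_def)
    have "U = principal {a}"
    proof (rule antisym)
      show "U \<le> principal {a}"
        using a by (simp add: le_principal)
      show "principal {a} \<le> U"
      proof (rule filter_leI)
        fix P assume "eventually P U"
        with a have "eventually (\<lambda>_. P a) U"
          by eventually_elim auto
        then show "eventually P (principal {a})"
          using u by (simp add: ultrafilter_def eventually_principal)
      qed
    qed
    with U show False
      by (simp add: nonprincipal_ultrafilter_def)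
  qed
  show "U \<le> cofinite"
  proof (rule filter_leI)
    fix P :: "'a \<Rightarrow> bool" assume "eventually P cofinite"
    then have "finite {x. \<not> P x}"
      by (simp add: eventually_cofinite)
    then have "eventually (\<lambda>x. \<forall>a\<in>{x. \<not> P x}. x \<noteq> a) U"
      using ne by (intro eventually_ball_finite) auto
    then show "eventually P U"
      by eventually_elim auto
  qed
next
  assume U: "ultrafilter U \<and> U \<le> cofinite"
  have "U \<noteq> principal {a}" for a
  proof
    assume a: "U = principal {a}"
    have "eventually (\<lambda>x. x \<noteq> a) cofinite"
      by (simp add: eventually_cofinite)
    then have "eventually (\<lambda>x. x \<noteq> a) U"
      using U by (auto simp: le_filter_def)
    with a show False
      by (simp add: eventually_principal)
  qed
  with U show "nonprincipal_ultrafilter U"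
    by (simp add: nonprincipal_ultrafilter_def)
qed

lemma nonprincipal_ultrafilter_exists: "\<exists>U :: nat filter. nonprincipal_ultrafilter U"
  using ultrafilter_below[of "sequentially"]
  by (auto simp: nonprincipal_ultrafilter_iff cofinite_eq_sequentially)

text \<open>A compact set contains a cluster point of the image filter, and an ultrafilter converges to each of
  its cluster points.\<close>

lemma ultrafilter_convergent:
  fixes f :: "'a \<Rightarrow> 'b::topological_space"
  assumes U: "ultrafilter U" and S: "compact S" and f: "\<And>x. f x \<in> S"
  shows "\<exists>l\<in>S. (f \<longlongrightarrow> l) U"
proof -
  have "filtermap f U \<noteq> bot" "filtermap f U \<le> principal S"
    using U f by (auto simp: ultrafilter_def filtermap_bot_iff le_principal eventually_filtermap)
  then obtain l where l: "l \<in> S" "inf (nhds l) (filtermap f U) \<noteq> bot"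
    using S unfolding compact_filter
    by (metis eventually_False eventually_filtermap le_principal)
  have "(f \<longlongrightarrow> l) U"
  proof (rule topological_tendstoI)
    fix T assume T: "open T" "l \<in> T"
    show "eventually (\<lambda>x. f x \<in> T) U"
    proof (rule ccontr)
      assume "\<not> ?thesis"
      then have "eventually (\<lambda>y. y \<notin> T) (filtermap f U)"
        using U by (auto simp: ultrafilter_def eventually_filtermap)
      moreover have "eventually (\<lambda>y. y \<in> T) (nhds l)"
        using T by (rule eventually_nhds_in_open)
      ultimately have "eventually (\<lambda>_. False) (inf (nhds l) (filtermap f U))"
        unfolding eventually_inf by blast
      with l(2) show False
        by (simp add: trivial_limit_def)
    qed
  qed
  with l(1) show ?thesis by blast
qed

lemma ultrafilter_convergent_bounded_real:
  fixes f :: "'a \<Rightarrow> real"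
  assumes "ultrafilter U" "\<And>x. \<bar>f x\<bar> \<le> B"
  obtains l where "(f \<longlongrightarrow> l) U" "\<bar>l\<bar> \<le> B"
proof -
  have "f x \<in> {- B..B}" for x
    using assms(2)[of x] by (simp add: abs_le_iff)
  then obtain l where "l \<in> {- B..B}" "(f \<longlongrightarrow> l) U"
    using ultrafilter_convergent[OF assms(1) compact_Icc] by blast
  then show ?thesis
    by (intro that) auto
qed

text \<open>This is the only consequence of stability that the lower bound needs: stable spaces do not see the
  order of the indices. With the inner limit over \<open>m\<close> almost all pairs have \<open>n \<le> m\<close>, with the inner
  limit over \<open>n\<close> almost all have \<open>m < n\<close>.\<close>

lemma stable_order_bound:
  fixes x y :: "nat \<Rightarrow> 'a::metric_space"
  assumes st: "stable_metric_space TYPE('a)"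
    and bd: "bounded (range x)" "bounded (range y)"
    and le: "\<And>n m. n \<le> m \<Longrightarrow> dist (x n) (y m) \<le> a"
    and ge: "\<And>n m. m < n \<Longrightarrow> b \<le> dist (x n) (y m)"
  shows "b \<le> a"
proof -
  obtain U :: "nat filter" where np: "nonprincipal_ultrafilter U"
    using nonprincipal_ultrafilter_exists by blast
  then have U: "ultrafilter U" and seq: "U \<le> sequentially"
    by (auto simp: nonprincipal_ultrafilter_iff cofinite_eq_sequentially)
  then have nb: "U \<noteq> bot"
    by (simp add: ultrafilter_def)
  have ev: "eventually P U" if "eventually P sequentially" for P
    using seq that by (auto simp: le_filter_def)
  obtain B where B: "\<And>n m. dist (x n) (y m) \<le> B"
  proof -
    have "bounded (range x \<union> range y)"
      using bd by simp
    then obtain B where "\<forall>u\<in>range x \<union> range y. \<forall>v\<in>range x \<union> range y. dist u v \<le> B"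
      unfolding bounded_two_points by blast
    then have "dist (x n) (y m) \<le> B" for n m
      by blast
    then show ?thesis
      by (rule that)
  qed
  have "\<exists>l. ((\<lambda>m. dist (x n) (y m)) \<longlongrightarrow> l) U \<and> \<bar>l\<bar> \<le> B" for n
    by (rule ultrafilter_convergent_bounded_real[OF U, of "\<lambda>m. dist (x n) (y m)"]) (use B in auto)
  then obtain r where r: "\<And>n. ((\<lambda>m. dist (x n) (y m)) \<longlongrightarrow> r n) U" "\<And>n. \<bar>r n\<bar> \<le> B"
    by metis
  have "\<exists>l. ((\<lambda>n. dist (x n) (y m)) \<longlongrightarrow> l) U \<and> \<bar>l\<bar> \<le> B" for m
    by (rule ultrafilter_convergent_bounded_real[OF U, of "\<lambda>n. dist (x n) (y m)"]) (use B in auto)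
  then obtain s where s: "\<And>m. ((\<lambda>n. dist (x n) (y m)) \<longlongrightarrow> s m) U" "\<And>m. \<bar>s m\<bar> \<le> B"
    by metis
  obtain R where R: "(r \<longlongrightarrow> R) U"
    by (rule ultrafilter_convergent_bounded_real[OF U r(2)])
  obtain S where S: "(s \<longlongrightarrow> S) U"
    by (rule ultrafilter_convergent_bounded_real[OF U s(2)])
  have "Lim U (\<lambda>n. Lim U (\<lambda>m. dist (x n) (y m))) = Lim U (\<lambda>m. Lim U (\<lambda>n. dist (x n) (y m)))"
    using st bd np unfolding stable_metric_space_def by blast
  then have RS: "R = S"
    by (simp add: tendsto_Lim[OF nb r(1)] tendsto_Lim[OF nb s(1)] tendsto_Lim[OF nb R]
        tendsto_Lim[OF nb S])
  have "r n \<le> a" for n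
    by (rule tendsto_upperbound[OF r(1) ev nb], rule eventually_sequentiallyI[of n]) (rule le)
  then have "R \<le> a"
    by (intro tendsto_upperbound[OF R _ nb] always_eventually) simp
  have "b \<le> s m" for m
    by (rule tendsto_lowerbound[OF s(1) ev nb], rule eventually_sequentiallyI[of "Suc m"])
      (rule ge, simp)
  then have "b \<le> S"
    by (intro tendsto_lowerbound[OF S _ nb] always_eventually) simp
  with \<open>R \<le> a\<close> RS show ?thesis by simp
qed

section \<open>Stability of the sequence space\<close>

lemma ell1_nth_le_norm: "\<bar>ell1_nth x k\<bar> \<le> norm x"
  using ell1_sum_le_norm[of "{k}" x] by simp

text \<open>The point \<open>p\<close> is the coordinatewise limit and \<open>a\<close> the limit of \<open>\<parallel>x\<^sub>n - p\<parallel>\<close>, the mass that escapes to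
  infinity. The differences \<open>\<bar>x\<^sub>n(k) - z(k)\<bar> - \<bar>x\<^sub>n(k) - p(k)\<bar>\<close> tend to \<open>\<bar>p(k) - z(k)\<bar>\<close> in each
  coordinate and are dominated by this summable limit, so their sums converge as well.\<close>

lemma ell1_ultralimit_dist:
  assumes U: "ultrafilter U" and bd: "bounded (range x)"
  obtains p a where "\<And>z :: ell1. ((\<lambda>n. dist (x n) z) \<longlongrightarrow> dist p z + a) U"
proof -
  have nb: "U \<noteq> bot"
    using U by (simp add: ultrafilter_def)
  obtain B where B: "\<And>n. norm (x n) \<le> B"
    using bd by (auto simp: bounded_iff)
  have "\<exists>l. ((\<lambda>n. ell1_nth (x n) k) \<longlongrightarrow> l) U \<and> \<bar>l\<bar> \<le> B" for k
    by (rule ultrafilter_convergent_bounded_real[OF U, of "\<lambda>n. ell1_nth (x n) k"])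
      (use B ell1_nth_le_norm order_trans in blast)+
  then obtain q where q: "\<And>k. ((\<lambda>n. ell1_nth (x n) k) \<longlongrightarrow> q k) U"
    by metis
  have "(\<Sum>k<m. \<bar>q k\<bar>) \<le> B" for m
  proof (rule tendsto_upperbound[OF _ _ nb])
    show "((\<lambda>n. \<Sum>k<m. \<bar>ell1_nth (x n) k\<bar>) \<longlongrightarrow> (\<Sum>k<m. \<bar>q k\<bar>)) U"
      by (intro tendsto_intros q)
    show "\<forall>\<^sub>F n in U. (\<Sum>k<m. \<bar>ell1_nth (x n) k\<bar>) \<le> B"
      using ell1_sum_le_norm[of "{..<m}"] B order_trans
      by (intro always_eventually) blast
  qed
  then have "summable (\<lambda>k. \<bar>q k\<bar>)"
    by (intro summableI_nonneg_bounded[of _ B]) auto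
  then obtain p where p: "ell1_nth p = q"
    by (metis Abs_ell1_inverse mem_Collect_eq)
  have "\<bar>norm (x n - p)\<bar> \<le> B + norm p" for n
    using norm_triangle_ineq4[of "x n" p] B[of n] by simp
  then obtain a where a: "((\<lambda>n. norm (x n - p)) \<longlongrightarrow> a) U"
    by (rule ultrafilter_convergent_bounded_real[OF U])
  have "((\<lambda>n. dist (x n) z) \<longlongrightarrow> dist p z + a) U" for z
  proof -
    let ?d = "\<lambda>k n. \<bar>ell1_nth (x n - z) k\<bar> - \<bar>ell1_nth (x n - p) k\<bar>"
    have "((\<lambda>n. \<Sum>k. ?d k n) \<longlongrightarrow> (\<Sum>k. \<bar>ell1_nth (p - z) k\<bar>)) U"
    proof (rule tannerys_theorem[THEN conjunct2, THEN conjunct2, OF _ _ _ nb])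
      show "((\<lambda>n. ?d k n) \<longlongrightarrow> \<bar>ell1_nth (p - z) k\<bar>) U" for k
      proof -
        have "((\<lambda>n. ?d k n) \<longlongrightarrow> \<bar>q k - ell1_nth z k\<bar> - \<bar>q k - q k\<bar>) U"
          unfolding minus_ell1.rep_eq p by (intro tendsto_intros q)
        then show ?thesis
          by (simp add: minus_ell1.rep_eq p)
      qed
      show "\<forall>\<^sub>F (k, n) in at_top \<times>\<^sub>F U. norm (?d k n) \<le> \<bar>ell1_nth (p - z) k\<bar>"
        by (intro always_eventually) (auto simp: minus_ell1.rep_eq)
      show "summable (\<lambda>k. \<bar>ell1_nth (p - z) k\<bar>)"
        by (rule ell1_summable)
    qed
    moreover have "(\<Sum>k. ?d k n) = norm (x n - z) - norm (x n - p)" for n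
      unfolding norm_ell1.rep_eq by (rule suminf_diff[symmetric]; rule ell1_summable)
    ultimately have "((\<lambda>n. norm (x n - z) - norm (x n - p)) \<longlongrightarrow> norm (p - z)) U"
      by (simp add: norm_ell1.rep_eq)
    from tendsto_add[OF this a] show ?thesis
      by (simp add: dist_norm)
  qed
  then show ?thesis
    by (rule that)
qed

lemma stable_ell1: "stable_metric_space TYPE(ell1)"
  unfolding stable_metric_space_def
proof (intro allI impI)
  fix x y :: "nat \<Rightarrow> ell1" and U V :: "nat filter"
  assume bd: "bounded (range x)" "bounded (range y)"
    and "nonprincipal_ultrafilter U" "nonprincipal_ultrafilter V"
  then have U: "ultrafilter U" "U \<noteq> bot" and V: "ultrafilter V" "V \<noteq> bot"
    by (auto simp: nonprincipal_ultrafilter_def ultrafilter_def)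
  obtain p a where p: "\<And>z. ((\<lambda>n. dist (x n) z) \<longlongrightarrow> dist p z + a) U"
    using ell1_ultralimit_dist[OF U(1) bd(1)] by metis
  obtain q b where q: "\<And>z. ((\<lambda>m. dist (y m) z) \<longlongrightarrow> dist q z + b) V"
    using ell1_ultralimit_dist[OF V(1) bd(2)] by metis
  have "Lim V (\<lambda>m. dist (x n) (y m)) = dist (x n) q + b" for n
    using tendsto_Lim[OF V(2) q[of "x n"]] by (simp add: dist_commute)
  moreover have "Lim U (\<lambda>n. dist (x n) q + b) = dist p q + a + b"
    by (intro tendsto_Lim U(2) tendsto_add p tendsto_const)
  moreover have "Lim U (\<lambda>n. dist (x n) (y m)) = dist (y m) p + a" for m
    using tendsto_Lim[OF U(2) p[of "y m"]] by (simp add: dist_commute)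
  moreover have "Lim V (\<lambda>m. dist (y m) p + a) = dist q p + b + a"
    by (intro tendsto_Lim V(2) tendsto_add q tendsto_const)
  ultimately show "Lim U (\<lambda>n. Lim V (\<lambda>m. dist (x n) (y m))) =
      Lim V (\<lambda>m. Lim U (\<lambda>n. dist (x n) (y m)))"
    by (simp add: dist_commute)
qed

section \<open>The graph metric\<close>

lemma ml1_walk:
  "(ml1_label x, ml1_label y) \<in>
    {(a, b). {a, b} \<in> ml1_edges} ^^ graph_dist ml1_edges (ml1_label x) (ml1_label y)"
  unfolding graph_dist_def by (rule LeastI_ex) (rule ml1_connected[OF ml1_label ml1_label])

lemma ml1_dist_le_walk:
  "(ml1_label x, ml1_label y) \<in> {(a, b). {a, b} \<in> ml1_edges} ^^ n \<Longrightarrow> dist x y \<le> n"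
  unfolding dist_ml1_def graph_dist_def by (simp add: Least_le)

text \<open>For a path metric the Lipschitz condition need only be checked on edges. The lemma serves both to
  bound distances from below and to produce elements of the dual of the free space.\<close>

lemma ml1_lipschitz:
  fixes g :: "ml1_label \<Rightarrow> real"
  assumes root: "\<And>n. Number n \<in> ml1_vertices \<Longrightarrow> \<bar>g (Number n) - g Origin\<bar> \<le> C"
    and mem: "\<And>n A. Number n \<in> ml1_vertices \<Longrightarrow> Subset A \<in> ml1_vertices \<Longrightarrow> n \<in> A \<Longrightarrow>
      \<bar>g (Number n) - g (Subset A)\<bar> \<le> C"
  shows "\<bar>g (ml1_label x) - g (ml1_label y)\<bar> \<le> C * dist x y"
proof -
  have edge: "\<bar>g a - g b\<bar> \<le> C" if "{a, b} \<in> ml1_edges" for a b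
    using that root mem unfolding ml1_edges_def
    by (auto simp: doubleton_eq_iff abs_minus_commute)
  have "\<bar>g a - g b\<bar> \<le> C * real n" if "(a, b) \<in> {(a, b). {a, b} \<in> ml1_edges} ^^ n" for a b n
    using that
  proof (induction n arbitrary: b)
    case (Suc n)
    then obtain c where "\<bar>g a - g c\<bar> \<le> C * real n" "{c, b} \<in> ml1_edges"
      by auto
    with edge[of c b] show ?case
      by (simp add: algebra_simps)
  qed simp
  from this[OF ml1_walk] show ?thesis
    by (simp add: dist_ml1_def)
qed

definition number_vertex :: "nat \<Rightarrow> ml1" where
  "number_vertex n = Abs_ml1 (Number n)"

definition subset_vertex :: "nat set \<Rightarrow> ml1" where
  "subset_vertex A = Abs_ml1 (Subset A)"

lemma ml1_vertices_simps [simp]: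
  "Origin \<in> ml1_vertices"
  "Number n \<in> ml1_vertices \<longleftrightarrow> n \<ge> 1"
  "Subset A \<in> ml1_vertices \<longleftrightarrow> A \<subseteq> {1..} \<and> finite A \<and> A \<noteq> {}"
  by (auto simp: ml1_vertices_def)

lemma label_base_point [simp]: "ml1_label base_point = Origin"
  by (simp add: base_point_ml1_def Abs_ml1_inverse)

lemma label_number_vertex [simp]: "n \<ge> 1 \<Longrightarrow> ml1_label (number_vertex n) = Number n"
  by (simp add: number_vertex_def Abs_ml1_inverse)

lemma label_subset_vertex [simp]:
  "A \<subseteq> {1..} \<Longrightarrow> finite A \<Longrightarrow> A \<noteq> {} \<Longrightarrow> ml1_label (subset_vertex A) = Subset A"
  by (simp add: subset_vertex_def Abs_ml1_inverse)

lemma ml1_cases: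
  obtains "x = base_point"
  | n where "n \<ge> 1" "x = number_vertex n"
  | A where "A \<subseteq> {1..}" "finite A" "A \<noteq> {}" "x = subset_vertex A"
proof (cases "ml1_label x")
  case Origin
  then show ?thesis
    using that(1) by (metis base_point_ml1_def ml1_label_inverse)
next
  case (Number n)
  then show ?thesis
    using that(2)[of n] ml1_label[of x] ml1_label_inverse[of x] by (simp add: number_vertex_def)
next
  case (Subset A)
  then show ?thesis
    using that(3)[of A] ml1_label[of x] ml1_label_inverse[of x] by (simp add: subset_vertex_def)
qed

lemma dist_number_base: "n \<ge> 1 \<Longrightarrow> dist (number_vertex n) base_point \<le> 1"
  using ml1_dist_le_walk[of "number_vertex n" base_point 1]
  by (auto simp: ml1_edges_def insert_commute)

lemma dist_number_subset_le:
  assumes "A \<subseteq> {1..}" "finite A" "n \<in> A"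
  shows "dist (number_vertex n) (subset_vertex A) \<le> 1"
proof -
  have "n \<ge> 1" "A \<noteq> {}" using assms by auto
  with assms show ?thesis
    using ml1_dist_le_walk[of "number_vertex n" "subset_vertex A" 1] by (auto simp: ml1_edges_def)
qed

lemma dist_base_le_2: "dist x base_point \<le> 2" for x :: ml1
proof (cases x rule: ml1_cases)
  case (2 n)
  then show ?thesis using dist_number_base[of n] by simp
next
  case (3 A)
  then obtain n where "n \<in> A" "n \<ge> 1" by fastforce
  with 3 show ?thesis
    using dist_triangle[of x base_point "number_vertex n"] dist_number_base[of n]
      dist_number_subset_le[of A n] by (simp add: dist_commute)
qed simp

text \<open>The witness \<open>g\<close> is the distance from \<open>n\<close>, written out; it changes by \<open>1\<close> along every edge.\<close>

lemma dist_number_subset_ge: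
  assumes "A \<subseteq> {1..}" "finite A" "A \<noteq> {}" "n \<ge> 1" "n \<notin> A"
  shows "3 \<le> dist (number_vertex n) (subset_vertex A)"
proof -
  define g :: "ml1_label \<Rightarrow> real" where "g l = (case l of Origin \<Rightarrow> 1 | Number k \<Rightarrow> if k = n then 0 else 2
      | Subset B \<Rightarrow> if n \<in> B then 1 else 3)" for l
  have "\<bar>g (ml1_label (number_vertex n)) - g (ml1_label (subset_vertex A))\<bar>
      \<le> 1 * dist (number_vertex n) (subset_vertex A)"
    by (rule ml1_lipschitz) (auto simp: g_def)
  with assms show ?thesis
    by (simp add: g_def)
qed

section \<open>The lower bound for embeddings into stable spaces\<close>

lemma stable_lipschitz_bounds:
  fixes f :: "ml1 \<Rightarrow> 'n::metric_space"
  assumes st: "stable_metric_space TYPE('n)" and f: "lipschitz_bounds f C1 C2"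
  shows "3 * C1 \<le> C2"
proof (rule stable_order_bound[OF st])
  let ?x = "\<lambda>n. f (number_vertex (Suc n))" and ?y = "\<lambda>m. f (subset_vertex {1..Suc m})"
  have C: "C1 > 0" "C2 > 0" and lo: "\<And>x y. C1 * dist x y \<le> dist (f x) (f y)"
    and hi: "\<And>x y. dist (f x) (f y) \<le> C2 * dist x y"
    using f by (auto simp: lipschitz_bounds_def)
  have "dist (f base_point) (f x) \<le> C2 * 2" for x
  proof -
    have "C2 * dist base_point x \<le> C2 * 2"
      using C dist_base_le_2[of x] by (intro mult_left_mono) (auto simp: dist_commute)
    then show ?thesis
      using hi[of base_point x] by simp
  qed
  then have "range f \<subseteq> cball (f base_point) (C2 * 2)"
    by auto
  then have "bounded (range f)"
    by (rule bounded_subset[OF bounded_cball])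
  then show "bounded (range ?x)" "bounded (range ?y)"
    by (auto elim: bounded_subset)
  show "dist (?x n) (?y m) \<le> C2" if "n \<le> m" for n m
  proof -
    have "dist (number_vertex (Suc n)) (subset_vertex {1..Suc m}) \<le> 1"
      using that by (intro dist_number_subset_le) auto
    then have "C2 * dist (number_vertex (Suc n)) (subset_vertex {1..Suc m}) \<le> C2 * 1"
      using C by (intro mult_left_mono) auto
    then show ?thesis
      using hi[of "number_vertex (Suc n)" "subset_vertex {1..Suc m}"] by simp
  qed
  show "3 * C1 \<le> dist (?x n) (?y m)" if "m < n" for n m
  proof -
    have "3 \<le> dist (number_vertex (Suc n)) (subset_vertex {1..Suc m})"
      using that by (intro dist_number_subset_ge) auto
    then have "C1 * 3 \<le> C1 * dist (number_vertex (Suc n)) (subset_vertex {1..Suc m})"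
      using C by (intro mult_left_mono) auto
    then show ?thesis
      using lo[of "number_vertex (Suc n)" "subset_vertex {1..Suc m}"] by simp
  qed
qed

lemma stable_not_lipschitz_embeds:
  assumes "stable_metric_space TYPE('n::metric_space)" "D < 3"
  shows "\<not> lipschitz_embeds TYPE(ml1) TYPE('n) D"
proof
  assume "lipschitz_embeds TYPE(ml1) TYPE('n) D"
  then obtain f :: "ml1 \<Rightarrow> 'n" where f: "lipschitz_embedding f" "distortion f \<le> D"
    by (auto simp: lipschitz_embeds_def)
  have "3 \<le> distortion f"
    unfolding distortion_def
  proof (rule cInf_greatest)
    show "{C2 / C1 |C1 C2. lipschitz_bounds f C1 C2} \<noteq> {}"
      using f(1) by (auto simp: lipschitz_embedding_def)
    fix d assume "d \<in> {C2 / C1 |C1 C2. lipschitz_bounds f C1 C2}"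
    then show "3 \<le> d"
      using stable_lipschitz_bounds[OF assms(1), of f]
      by (auto simp: lipschitz_bounds_def pos_le_divide_eq)
  qed
  with f(2) assms(2) show False by simp
qed

section \<open>Free spaces\<close>

definition free_delta :: "'a::pointed_metric_space \<Rightarrow> 'a free_space" where
  "free_delta x = Abs_free_space (lip0_eval x)"

definition pairing :: "'a::pointed_metric_space lip0 \<Rightarrow> 'a free_space \<Rightarrow> real" where
  "pairing f u = blinfun_apply (free_space_functional u) f"

lemma free_space_functional_delta [simp]: "free_space_functional (free_delta x) = lip0_eval x"
  unfolding free_delta_def
  by (rule Abs_free_space_inverse) (auto intro: subsetD[OF closure_subset] span_base)

lemma bounded_linear_free_space_functional: "bounded_linear free_space_functional"
  by (rule bounded_linear_intro[where K = 1])
    (simp_all add: plus_free_space.rep_eq scaleR_free_space.rep_eq norm_free_space.rep_eq)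

lemma bounded_linear_pairing: "bounded_linear (pairing f)"
  unfolding pairing_def
  by (rule bounded_linear_compose[OF blinfun.bounded_linear_left
        bounded_linear_free_space_functional])

lemma pairing_le: "\<bar>pairing f u\<bar> \<le> norm u * norm f"
  using norm_blinfun[of "free_space_functional u" f]
  by (simp add: pairing_def norm_free_space.rep_eq)

lemma pairing_delta [simp]: "pairing f (free_delta x) = lip0_apply f x"
  by (simp add: pairing_def lip0_eval.rep_eq)

lemma pairing_delta_diff: "pairing f (free_delta x - free_delta y) = lip0_apply f x - lip0_apply f y"
  using linear_diff[OF bounded_linear.linear[OF bounded_linear_pairing[of f]]] by simp

text \<open>The upper estimate is the definition of the norm; the lower one evaluates at the \<open>1\<close>-Lipschitz
  function \<open>z \<mapsto> d(z, y)\<close>, shifted to vanish at the base point.\<close>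

lemma dist_free_delta: "dist (free_delta x) (free_delta y) = dist x y"
  for x y :: "'a::pointed_metric_space"
proof (rule antisym)
  show "dist (free_delta x) (free_delta y) \<le> dist x y"
    unfolding dist_norm norm_free_space.rep_eq minus_free_space.rep_eq free_space_functional_delta
  proof (rule norm_blinfun_bound)
    show "norm (blinfun_apply (lip0_eval x - lip0_eval y) f) \<le> dist x y * norm f" for f
      using lipschitz_onD[OF lip0_lipschitz[of f], of x y]
      by (simp add: blinfun.diff_left lip0_eval.rep_eq dist_real_def mult.commute)
  qed simp
  define f where "f = Abs_lip0 (\<lambda>z. dist z y - dist base_point y)"
  have lip: "1-lipschitz_on UNIV (\<lambda>z. dist z y - dist base_point y)"
  proof (rule lipschitz_onI)
    show "dist (dist u y - dist base_point y) (dist w y - dist base_point y) \<le> 1 * dist u w"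
      for u w :: 'a
      using abs_dist_diff_le[of u y w] by (simp add: dist_real_def dist_commute[of y w])
  qed simp
  then have f: "lip0_apply f = (\<lambda>z. dist z y - dist base_point y)"
    unfolding f_def by (intro Abs_lip0_inverse) auto
  have "norm f \<le> 1"
    by (rule lip0_norm_le) (simp add: f lip)
  have "dist x y = pairing f (free_delta x - free_delta y)"
    by (simp add: pairing_delta_diff f)
  also have "\<dots> \<le> norm (free_delta x - free_delta y) * norm f"
    using pairing_le[of f "free_delta x - free_delta y"] by simp
  also have "\<dots> \<le> norm (free_delta x - free_delta y) * 1"
    using \<open>norm f \<le> 1\<close> by (rule mult_left_mono) simp
  finally show "dist x y \<le> dist (free_delta x) (free_delta y)"
    by (simp add: dist_norm)
qed

lemma free_delta_base_point [simp]: "free_delta base_point = (0 :: 'a::pointed_metric_space free_space)"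
proof -
  have "lip0_eval (base_point :: 'a) = 0"
    using lip0_apply by (intro blinfun_eqI) (auto simp: lip0_eval.rep_eq)
  then show ?thesis
    by (simp add: free_space_functional_inject[symmetric] zero_free_space.rep_eq)
qed

text \<open>An operator that is bounded below has closed range, so it is onto as soon as its range contains the
  evaluations, whose span is dense.\<close>

lemma free_space_range_eq_UNIV:
  fixes T :: "'b::banach \<Rightarrow> 'a::pointed_metric_space free_space"
  assumes T: "bounded_linear T" and c: "c > 0" "\<And>u. c * norm u \<le> norm (T u)"
    and delta: "\<And>x. free_delta x \<in> range T"
  shows "range T = UNIV"
proof -
  let ?J = "\<lambda>u. free_space_functional (T u)"
  have J: "bounded_linear ?J"
    by (rule bounded_linear_compose[OF bounded_linear_free_space_functional T])
  have "complete (range ?J)"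
    using c by (intro complete_isometric_image[OF c(1) subspace_UNIV J])
      (auto simp: norm_free_space.rep_eq[symmetric] complete_UNIV)
  then have "closed (range ?J)"
    by (rule complete_imp_closed)
  moreover have "range lip0_eval \<subseteq> range ?J"
    using delta by (metis (no_types, lifting) free_space_functional_delta image_iff image_subsetI rangeI)
  then have "span (range lip0_eval) \<subseteq> range ?J"
    by (rule span_minimal) (intro linear_subspace_image bounded_linear.linear[OF J] subspace_UNIV)
  ultimately have "closure (span (range lip0_eval)) \<subseteq> range ?J"
    by (intro closure_minimal)
  then show ?thesis
    using free_space_functional by (force simp: free_space_functional_inject)
qed

section \<open>Operators on the sequence space\<close>

definition ell1_synthesis :: "(nat \<Rightarrow> 'a::banach) \<Rightarrow> ell1 \<Rightarrow> 'a" where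
  "ell1_synthesis v u = (\<Sum>n. ell1_nth u n *\<^sub>R v n)"

definition ell1_unit :: "nat \<Rightarrow> ell1" where
  "ell1_unit k = Abs_ell1 (\<lambda>n. if n = k then 1 else 0)"

lemma ell1_nth_unit: "ell1_nth (ell1_unit k) = (\<lambda>n. if n = k then 1 else 0)"
proof -
  have "summable (\<lambda>n. \<bar>if n = k then 1 else 0 :: real\<bar>)"
    by (rule summable_finite[of "{k}"]) auto
  then show ?thesis
    by (simp add: ell1_unit_def Abs_ell1_inverse)
qed

lemma ell1_synthesis_unit: "ell1_synthesis v (ell1_unit k) = v k"
proof -
  have "(\<lambda>n. ell1_nth (ell1_unit k) n *\<^sub>R v n) = (\<lambda>n. if n = k then v n else 0)"
    by (auto simp: ell1_nth_unit)
  then show ?thesis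
    using sums_single[of k v] by (simp add: ell1_synthesis_def sums_iff)
qed

lemma
  fixes v :: "nat \<Rightarrow> 'a::banach"
  assumes v: "\<And>n. norm (v n) \<le> C"
  shows summable_ell1_synthesis: "summable (\<lambda>n. ell1_nth u n *\<^sub>R v n)"
    and norm_ell1_synthesis: "norm (ell1_synthesis v u) \<le> C * norm u"
proof -
  have le: "norm (ell1_nth u n *\<^sub>R v n) \<le> C * \<bar>ell1_nth u n\<bar>" for n
    using mult_left_mono[OF v[of n], of "\<bar>ell1_nth u n\<bar>"] by (simp add: mult.commute)
  have s: "summable (\<lambda>n. C * \<bar>ell1_nth u n\<bar>)"
    by (intro summable_mult ell1_summable)
  show "summable (\<lambda>n. ell1_nth u n *\<^sub>R v n)"
    by (rule summable_comparison_test'[OF s le])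
  have "norm (ell1_synthesis v u) \<le> (\<Sum>n. C * \<bar>ell1_nth u n\<bar>)"
    unfolding ell1_synthesis_def by (rule norm_suminf_le[OF le s])
  also have "\<dots> = C * norm u"
    by (simp add: norm_ell1.rep_eq suminf_mult ell1_summable)
  finally show "norm (ell1_synthesis v u) \<le> C * norm u" .
qed

lemma bounded_linear_ell1_synthesis:
  fixes v :: "nat \<Rightarrow> 'a::banach"
  assumes v: "\<And>n. norm (v n) \<le> C"
  shows "bounded_linear (ell1_synthesis v)"
proof (rule bounded_linear_intro)
  note s = summable_ell1_synthesis[of v C, OF v]
  show "ell1_synthesis v (x + y) = ell1_synthesis v x + ell1_synthesis v y" for x y
    by (simp add: ell1_synthesis_def plus_ell1.rep_eq scaleR_left_distrib suminf_add s)
  show "ell1_synthesis v (r *\<^sub>R x) = r *\<^sub>R ell1_synthesis v x" for r x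
    using bounded_linear.suminf[OF bounded_linear_scaleR_right s, of r x]
    by (simp add: ell1_synthesis_def scaleR_ell1.rep_eq)
  show "norm (ell1_synthesis v x) \<le> norm x * C" for x
    using norm_ell1_synthesis[of v C x, OF v] by (simp add: mult.commute)
qed

section \<open>The spanning tree and its potentials\<close>

text \<open>The value \<open>base_point\<close> at the base point itself is a dummy.\<close>

definition parent :: "ml1 \<Rightarrow> ml1" where
  "parent x = (case ml1_label x of Subset A \<Rightarrow> number_vertex (Min A) | _ \<Rightarrow> base_point)"

lemma Min_ge_1: "A \<subseteq> {1..} \<Longrightarrow> finite A \<Longrightarrow> A \<noteq> {} \<Longrightarrow> 1 \<le> Min A" for A :: "nat set"
  using Min_in[of A] by auto

lemma parent_simps [simp]:
  "n \<ge> 1 \<Longrightarrow> parent (number_vertex n) = base_point"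
  "A \<subseteq> {1..} \<Longrightarrow> finite A \<Longrightarrow> A \<noteq> {} \<Longrightarrow> parent (subset_vertex A) = number_vertex (Min A)"
  by (auto simp: parent_def)

lemma dist_parent_le: "x \<noteq> base_point \<Longrightarrow> dist x (parent x) \<le> 1"
proof (cases x rule: ml1_cases)
  case (3 A)
  then show ?thesis
    using dist_number_subset_le[of A "Min A"] by (simp add: dist_commute)
qed (use dist_number_base in auto)

text \<open>Increments along the edges of the spanning tree can be prescribed freely and are summed up from the
  root. The constant \<open>3\<close> comes from an edge \<open>{n, A}\<close> with \<open>n \<noteq> Min A\<close>, over which the increments of
  the three tree edges \<open>n\<close> -- \<open>0\<close> -- \<open>Min A\<close> -- \<open>A\<close> add up.\<close>

lemma tree_potential:
  fixes s :: "ml1 \<Rightarrow> real"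
  assumes s: "\<And>x. \<bar>s x\<bar> \<le> 1"
  obtains f where "norm f \<le> 3"
    "\<And>x. x \<noteq> base_point \<Longrightarrow> lip0_apply f x - lip0_apply f (parent x) = s x"
proof -
  define g where "g l = (case l of Origin \<Rightarrow> 0 | Number n \<Rightarrow> s (number_vertex n)
      | Subset A \<Rightarrow> s (number_vertex (Min A)) + s (subset_vertex A))" for l
  have "\<bar>g (ml1_label x) - g (ml1_label y)\<bar> \<le> 3 * dist x y" for x y
  proof (rule ml1_lipschitz)
    show "\<bar>g (Number n) - g Origin\<bar> \<le> 3" for n
      using s[of "number_vertex n"] by (simp add: g_def)
    show "\<bar>g (Number n) - g (Subset A)\<bar> \<le> 3" for n A
      using s[of "number_vertex n"] s[of "number_vertex (Min A)"] s[of "subset_vertex A"]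
      by (simp add: g_def)
  qed
  then have lip: "3-lipschitz_on UNIV (\<lambda>x. g (ml1_label x))"
    by (intro lipschitz_onI) (auto simp: dist_real_def)
  define f where "f = Abs_lip0 (\<lambda>x. g (ml1_label x))"
  have f: "lip0_apply f = (\<lambda>x. g (ml1_label x))"
    unfolding f_def using lip by (intro Abs_lip0_inverse) (auto simp: g_def)
  show ?thesis
  proof (rule that)
    show "norm f \<le> 3"
      by (rule lip0_norm_le) (simp add: f lip)
    show "lip0_apply f x - lip0_apply f (parent x) = s x" if "x \<noteq> base_point" for x
      using that Min_ge_1 by (cases x rule: ml1_cases) (auto simp: f g_def)
  qed
qed

lemma ml1_enumeration: "\<exists>e. bij_betw e (UNIV :: nat set) (UNIV - {base_point :: ml1})"
proof -
  have "countable (insert Origin (range Number \<union> Subset ` {A. finite A}))"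
    by (simp add: countable_Collect_finite)
  then have "countable ml1_vertices"
    by (rule countable_subset[rotated]) (auto simp: ml1_vertices_def)
  then have "countable (range ml1_label)"
    by (rule countable_subset[rotated]) (use ml1_label in auto)
  then have "countable (UNIV :: ml1 set)"
    by (rule countable_image_inj_on) (auto intro: injI simp: ml1_label_inject)
  moreover have "inj (\<lambda>n. number_vertex (Suc n))"
  proof (rule injI)
    fix m n assume "number_vertex (Suc m) = number_vertex (Suc n)"
    then have "ml1_label (number_vertex (Suc m)) = ml1_label (number_vertex (Suc n))"
      by (rule arg_cong)
    then show "m = n" by simp
  qed
  then have "infinite (UNIV :: ml1 set)"
    using range_inj_infinite infinite_super[OF subset_UNIV] by blast
  ultimately have "countable (UNIV - {base_point :: ml1})" "infinite (UNIV - {base_point :: ml1})"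
    by auto
  then show ?thesis
    using bij_betw_from_nat_into by blast
qed

section \<open>Isomorphisms between the sequence space and the free space\<close>

text \<open>For the estimate from below, \<open>T u\<close> is paired with the potential whose increment at the \<open>n\<close>-th tree edge
  is the sign of \<open>u n\<close>: the pairing is \<open>\<parallel>u\<parallel>\<close> and the potential has norm at most \<open>3\<close>. Surjectivity
  holds because every evaluation is a sum of at most two differences along tree edges.\<close>

lemma ell1_free_ml1_isomorphism:
  obtains T :: "ell1 \<Rightarrow> ml1 free_space"
  where "bounded_linear T" "bij T" "\<And>u. norm (T u) \<le> norm u" "\<And>u. norm u \<le> 3 * norm (T u)"
proof -
  obtain e where e: "bij_betw e (UNIV :: nat set) (UNIV - {base_point :: ml1})"
    using ml1_enumeration by blast
  then have e_ne: "e n \<noteq> base_point" for n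
    by (auto dest: bij_betwE)
  define v where "v n = free_delta (e n) - free_delta (parent (e n))" for n
  define T where "T = ell1_synthesis v"
  have v: "norm (v n) \<le> 1" for n
    using dist_parent_le[OF e_ne[of n]] dist_free_delta[of "e n" "parent (e n)"]
    by (simp add: v_def dist_norm)
  have lin: "bounded_linear T"
    unfolding T_def by (rule bounded_linear_ell1_synthesis[OF v])
  have up: "norm (T u) \<le> norm u" for u
    using norm_ell1_synthesis[of v 1 u] v by (simp add: T_def)
  have low: "norm u \<le> 3 * norm (T u)" for u
  proof -
    obtain f where f: "norm f \<le> 3" "\<And>x. x \<noteq> base_point \<Longrightarrow>
        lip0_apply f x - lip0_apply f (parent x) = sgn (ell1_nth u (inv e x))"
      by (rule tree_potential[of "\<lambda>x. sgn (ell1_nth u (inv e x))"]) (auto simp: sgn_if)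
    have "inv e (e n) = n" for n
      using e by (simp add: bij_betw_def)
    then have "pairing f (v n) = sgn (ell1_nth u n)" for n
      by (simp add: v_def pairing_delta_diff f(2) e_ne)
    then have "pairing f (ell1_nth u n *\<^sub>R v n) = \<bar>ell1_nth u n\<bar>" for n
      using linear_scale[OF bounded_linear.linear[OF bounded_linear_pairing[of f]]]
      by (simp add: abs_sgn[symmetric])
    then have "norm u = pairing f (T u)"
      using bounded_linear.suminf[OF bounded_linear_pairing summable_ell1_synthesis[OF v], of f u]
      by (simp add: T_def ell1_synthesis_def norm_ell1.rep_eq)
    also have "\<dots> \<le> norm (T u) * norm f"
      using pairing_le[of f "T u"] by simp
    also have "\<dots> \<le> norm (T u) * 3"
      using f(1) by (rule mult_left_mono) simp
    finally show ?thesis by simp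
  qed
  have sub: "subspace (range T)"
    by (intro linear_subspace_image bounded_linear.linear[OF lin] subspace_UNIV)
  have diff_mem: "free_delta x - free_delta (parent x) \<in> range T" if "x \<noteq> base_point" for x
  proof -
    obtain n where "x = e n"
      using e \<open>x \<noteq> base_point\<close> by (auto simp: bij_betw_def)
    then have "free_delta x - free_delta (parent x) = T (ell1_unit n)"
      by (simp add: T_def ell1_synthesis_unit v_def)
    then show ?thesis by simp
  qed
  have step: "free_delta x \<in> range T"
    if "x \<noteq> base_point" "free_delta (parent x) \<in> range T" for x
  proof -
    have "(free_delta x - free_delta (parent x)) + free_delta (parent x) \<in> range T"
      using that diff_mem by (intro subspace_add[OF sub])
    then show ?thesis by (simp only: diff_add_cancel)
  qed
  have base: "free_delta base_point \<in> range T"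
    using subspace_0[OF sub] by simp
  have num: "free_delta (number_vertex n) \<in> range T" if "n \<ge> 1" for n
    using step[of "number_vertex n"] base that by (cases "number_vertex n = base_point") auto
  have "free_delta x \<in> range T" for x
  proof (cases x rule: ml1_cases)
    case (3 A)
    then show ?thesis
      using step[of x] base num[OF Min_ge_1] by (cases "x = base_point") auto
  qed (use base num in auto)
  then have "range T = UNIV"
    using low by (intro free_space_range_eq_UNIV[OF lin, of "1 / 3"]) (auto simp: mult.commute)
  moreover have "inj T"
    unfolding linear_injective_0[OF bounded_linear.linear[OF lin]]
  proof (intro allI impI)
    fix u assume "T u = 0"
    with low[of u] show "u = 0" by simp
  qed
  ultimately show ?thesis
    using that lin up low by (simp add: bij_def)
qed

text \<open>Restricting the inverse of an isomorphism to the isometric copy of the metric space in its free space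
  turns norms of operators into Lipschitz constants. It is used in both directions: to embed the graph
  and to bound the Banach-Mazur distance.\<close>

lemma isomorphism_lipschitz_bounds:
  fixes T :: "'b::banach \<Rightarrow> 'a::pointed_metric_space free_space"
  assumes T: "bounded_linear T" "bij T" "bounded_linear (inv T)"
    and K: "K > 0" "\<And>u. norm (T u) \<le> K * norm u"
    and L: "L > 0" "\<And>w. norm (inv T w) \<le> L * norm w"
  shows "lipschitz_bounds (\<lambda>x. inv T (free_delta x)) (1 / K) L"
  unfolding lipschitz_bounds_def
proof (intro conjI allI)
  fix x y :: 'a
  have diff: "inv T (free_delta x) - inv T (free_delta y) = inv T (free_delta x - free_delta y)"
    using linear_diff[OF bounded_linear.linear[OF T(3)]] by simp
  show "dist (inv T (free_delta x)) (inv T (free_delta y)) \<le> L * dist x y"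
    unfolding dist_norm[of "inv T _"] diff
    using L(2)[of "free_delta x - free_delta y"] dist_free_delta[of x y] by (simp add: dist_norm)
  have "dist x y \<le> K * norm (inv T (free_delta x - free_delta y))"
    using K(2)[of "inv T (free_delta x - free_delta y)"] dist_free_delta[of x y]
      surj_f_inv_f[OF bij_is_surj[OF T(2)]] by (simp add: dist_norm)
  then show "1 / K * dist x y \<le> dist (inv T (free_delta x)) (inv T (free_delta y))"
    unfolding dist_norm[of "inv T _"] diff using K(1) by (simp add: pos_divide_le_eq mult.commute)
qed (use K L in auto)

lemma ell1_free_ml1_norm_product:
  fixes T :: "ell1 \<Rightarrow> ml1 free_space"
  assumes T: "bounded_linear T" "bij T" "bounded_linear (inv T)"
  shows "3 \<le> onorm T * onorm (inv T)"
proof -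
  have "ell1_unit 0 \<noteq> 0"
    by (metis ell1_nth_unit zero_ell1.rep_eq zero_neq_one)
  moreover have "T 0 = 0"
    by (rule linear_0[OF bounded_linear.linear[OF T(1)]])
  moreover have "inv T (T u) = u" for u
    using T(2) by (simp add: bij_is_inj)
  ultimately have "\<exists>u. T u \<noteq> 0" "\<exists>w. inv T w \<noteq> 0"
    by metis+
  then have pos: "0 < onorm T" "0 < onorm (inv T)"
    using onorm_pos_lt[OF T(1)] onorm_pos_lt[OF T(3)] by auto
  have "lipschitz_bounds (\<lambda>x. inv T (free_delta x)) (1 / onorm T) (onorm (inv T))"
    by (intro isomorphism_lipschitz_bounds T pos onorm[OF T(1)] onorm[OF T(3)])
  then have "3 * (1 / onorm T) \<le> onorm (inv T)"
    by (rule stable_lipschitz_bounds[OF stable_ell1])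
  then show ?thesis
    using pos by (simp add: pos_divide_le_eq mult.commute)
qed

theorem mainTheorem4:
  shows "(stable_metric_space TYPE('n::metric_space) \<longrightarrow>
            (\<forall>D<3. \<not> lipschitz_embeds TYPE(ml1) TYPE('n) D)) \<and>
         (lipschitz_embeds TYPE(ml1) TYPE(ell1) 3 \<and>
            (\<forall>D<3. \<not> lipschitz_embeds TYPE(ml1) TYPE(ell1) D)) \<and>
         banach_mazur_distance TYPE(ell1) TYPE(ml1 free_space) = 3"
proof (intro conjI impI allI)
  obtain T :: "ell1 \<Rightarrow> ml1 free_space" where T: "bounded_linear T" "bij T"
    and up: "\<And>u. norm (T u) \<le> norm u" and low: "\<And>u. norm u \<le> 3 * norm (T u)"
    using ell1_free_ml1_isomorphism by metis
  have inv_le: "norm (inv T w) \<le> 3 * norm w" for w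
    using low[of "inv T w"] surj_f_inv_f[OF bij_is_surj[OF T(2)]] by simp
  obtain S where S: "linear S" "S \<circ> T = id"
    using linear_injective_left_inverse[OF bounded_linear.linear[OF T(1)] bij_is_inj[OF T(2)]]
    by blast
  then have "S (T u) = u" for u
    by (simp add: fun_eq_iff)
  then have "inv T = S"
    using surj_f_inv_f[OF bij_is_surj[OF T(2)]] by (intro ext) metis
  with S have "linear (inv T)"
    by simp
  then have inv: "bounded_linear (inv T)"
    using inv_le by (auto simp: bounded_linear_def bounded_linear_axioms_def mult.commute intro!: exI[of _ 3])
  show "\<not> lipschitz_embeds TYPE(ml1) TYPE('n) D"
    if "stable_metric_space TYPE('n)" "D < 3" for D
    by (rule stable_not_lipschitz_embeds[OF that])
  show "\<not> lipschitz_embeds TYPE(ml1) TYPE(ell1) D" if "D < 3" for D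
    by (rule stable_not_lipschitz_embeds[OF stable_ell1 that])
  show "lipschitz_embeds TYPE(ml1) TYPE(ell1) 3"
  proof -
    let ?f = "\<lambda>x. inv T (free_delta x)"
    have bounds: "lipschitz_bounds ?f 1 3"
      using isomorphism_lipschitz_bounds[OF T inv, of 1 3] up inv_le by simp
    have "distortion ?f \<le> 3"
      unfolding distortion_def
    proof (rule cInf_lower)
      show "3 \<in> {C2 / C1 |C1 C2. lipschitz_bounds ?f C1 C2}"
        using bounds by force
      show "bdd_below {C2 / C1 |C1 C2. lipschitz_bounds ?f C1 C2}"
        by (rule bdd_belowI[of _ 0]) (auto simp: lipschitz_bounds_def)
    qed
    with bounds show ?thesis
      unfolding lipschitz_embeds_def lipschitz_embedding_def by blast
  qed
  show "banach_mazur_distance TYPE(ell1) TYPE(ml1 free_space) = 3"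
    unfolding banach_mazur_distance_def
  proof (rule antisym)
    have "onorm T \<le> 1"
      using up by (intro onorm_bound) auto
    moreover have "onorm (inv T) \<le> 3"
      using inv_le by (intro onorm_bound) auto
    ultimately have "onorm T * onorm (inv T) \<le> 1 * 3"
      by (intro mult_mono) (auto intro: onorm_pos_le[OF inv])
    then show "Inf {ereal (onorm T * onorm (inv T)) | T :: ell1 \<Rightarrow> ml1 free_space.
        bounded_linear T \<and> bij T \<and> bounded_linear (inv T)} \<le> 3"
      using T inv by (intro Inf_lower2[of "ereal (onorm T * onorm (inv T))"]) auto
    show "3 \<le> Inf {ereal (onorm T * onorm (inv T)) | T :: ell1 \<Rightarrow> ml1 free_space.
        bounded_linear T \<and> bij T \<and> bounded_linear (inv T)}"
      using ell1_free_ml1_norm_product by (intro Inf_greatest) auto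
  qed
qed

end
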